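(* Let $S$ be an $L$-filter of an $L$-ordered group $(G;e,+,0)$ and let $\alpha=S(0)$. (i) $(G+S;\tilde e,\oplus,S)$ is an $L$-ordered group, where $\tilde e:(G+S)\times(G+S)\to L$ is the map sending every element $(a+S,b+S)$ to $\bigvee_{x\in S^{-1}(\alpha)}e(a-b,x)$. (ii) The map $\tilde S:G+S\to L$ defined by $\tilde S(a+S)=S(a)$ for all $a\in G$ is an $L$-filter of $(G+S;\tilde e,\oplus,S)$ such that $(\tilde S)^{-1}(\alpha)$ has exactly one element.
   Context: $L$ is a fixed frame, i.e. a complete lattice (bottom $0$, top $1$) with $a\wedge\bigvee T=\bigvee_{t\in T}(a\wedge t)$ for all $a\in L$, $T\subseteq L$. An $L$-ordered set is a pair $(P;e)$ with $e:P\times P\to L$ such that for all $x,y,z\in P$: $e(x,x)=1$; $e(x,y)\wedge e(y,z)\le e(x,z)$; and $e(x,y)=e(y,x)=1$ implies $x=y$. An $L$-ordered group $(G;e,+,0)$ is a (not necessarily abelian) group $(G;+,0)$, written additively, with an $L$-ordered set structure $(G;e)$ such that $e(x,y)\le e(b+x+a,b+y+a)$ for all $x,y,a,b\in G$. An $L$-subgroup of $G$ is a map $S:G\to L$ with $S(x)\wedge S(y)\le S(x+y)$ and $S(x)=S(-x)$ for all $x,y\in G$; it is normal if $S(y)\le S(x+y-x)$ for all $x,y\in G$. A map $S:G\to L$ is convex if $S(a)\ge S(x)\wedge S(y)\wedge e(x,a)\wedge e(a,y)$ for all $x,y,a\in G$. An $L$-filter of $(G;e,+,0)$ is a normal convex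 $L$-subgroup. For $x\in G$, $x+S:G\to L$ is the map $(x+S)(y)=\bigvee\{S(t)\mid t\in G,\ x+t=y\}=S(-x+y)$. For a normal $L$-subgroup $S$, the set $G+S=\{x+S\mid x\in G\}$ is a group under $(x+S)\oplus(y+S)=(x+y)+S$, with neutral element $S=0+S$ and $-(x+S)=-x+S$ (known). $S^{-1}(\alpha)=\{x\in G\mid S(x)=\alpha\}$. Part of the assertion is that $\tilde e$ and $\tilde S$ are well defined. *)

theory Defs
  imports "HOL-Algebra.Group"
begin

text \<open>
  The groups below need not be abelian. HOL-Algebra reserves additive notation for abelian
  groups, so everything is written multiplicatively: \<open>x \<otimes> y\<close> for \<open>x + y\<close>, \<open>inv x\<close> for \<open>-x\<close>,
  \<open>\<one>\<close> for \<open>0\<close>. The carrier is an arbitrary set; a map \<open>G \<rightarrow> L\<close> is a HOL function of which only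
  the values on the carrier matter.
\<close>

class frame = complete_lattice +
  assumes inf_Sup_frame: "inf a (Sup T) = (SUP t\<in>T. inf a t)"

locale L_ordered_set =
  fixes P :: "'a set" and e :: "'a \<Rightarrow> 'a \<Rightarrow> 'l::frame"
  assumes L_refl: "x \<in> P \<Longrightarrow> e x x = Orderings.top"
    and L_trans: "\<lbrakk>x \<in> P; y \<in> P; z \<in> P\<rbrakk> \<Longrightarrow> inf (e x y) (e y z) \<le> e x z"
    and L_antisym: "\<lbrakk>x \<in> P; y \<in> P; e x y = Orderings.top; e y x = Orderings.top\<rbrakk> \<Longrightarrow> x = y"

locale L_ordered_group = group G + L_ordered_set "carrier G" e
  for G :: "('a, 'b) monoid_scheme" (structure) and e :: "'a \<Rightarrow> 'a \<Rightarrow> 'l::frame" +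
  assumes L_compat: "\<lbrakk>x \<in> carrier G; y \<in> carrier G; a \<in> carrier G; b \<in> carrier G\<rbrakk>
    \<Longrightarrow> e x y \<le> e (b \<otimes> x \<otimes> a) (b \<otimes> y \<otimes> a)"

locale L_subgroup = group G
  for G :: "('a, 'b) monoid_scheme" (structure) and S :: "'a \<Rightarrow> 'l::frame" +
  assumes L_mult: "\<lbrakk>x \<in> carrier G; y \<in> carrier G\<rbrakk> \<Longrightarrow> inf (S x) (S y) \<le> S (x \<otimes> y)"
    and L_inv: "x \<in> carrier G \<Longrightarrow> S x = S (inv x)"

locale normal_L_subgroup = L_subgroup +
  assumes L_normal: "\<lbrakk>x \<in> carrier G; y \<in> carrier G\<rbrakk> \<Longrightarrow> S y \<le> S (x \<otimes> y \<otimes> inv x)"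

definition L_convex :: "'a set \<Rightarrow> ('a \<Rightarrow> 'a \<Rightarrow> 'l) \<Rightarrow> ('a \<Rightarrow> 'l::frame) \<Rightarrow> bool" where
  "L_convex P e S \<longleftrightarrow>
    (\<forall>x\<in>P. \<forall>y\<in>P. \<forall>a\<in>P. inf (inf (inf (S x) (S y)) (e x a)) (e a y) \<le> S a)"

locale L_filter = L_ordered_group G e + normal_L_subgroup G S
  for G :: "('a, 'b) monoid_scheme" (structure)
    and e :: "'a \<Rightarrow> 'a \<Rightarrow> 'l::frame" and S :: "'a \<Rightarrow> 'l" +
  assumes convex: "L_convex (carrier G) e S"

definition L_level :: "('a, 'b) monoid_scheme \<Rightarrow> ('a \<Rightarrow> 'l) \<Rightarrow> 'l \<Rightarrow> 'a set" where
  "L_level G S \<alpha> = {x \<in> carrier G. S x = \<alpha>}"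

text \<open>
  The coset \<open>x + S\<close>. Off the carrier the supremum is over the empty set, so the value there is
  \<open>bot\<close>; hence two cosets are equal as HOL functions iff they agree on the carrier.
\<close>

definition L_coset :: "('a, 'b) monoid_scheme \<Rightarrow> ('a \<Rightarrow> 'l::frame) \<Rightarrow> 'a \<Rightarrow> 'a \<Rightarrow> 'l" where
  "L_coset G S x = (\<lambda>y. Sup {S t | t. t \<in> carrier G \<and> x \<otimes>\<^bsub>G\<^esub> t = y})"

text \<open>
  Operations on cosets are given by the value on representatives; the description operator \<open>THE\<close>
  has the intended meaning exactly when that value does not depend on the representatives
  (\<open>L_quot_mult\<close> below for the product). The neutral element is \<open>S\<close> in the form \<open>0 + S\<close>
  (\<open>L_coset_one\<close> below).
\<close>

definition L_quot :: "('a, 'b) monoid_scheme \<Rightarrow> ('a \<Rightarrow> 'l::frame) \<Rightarrow> ('a \<Rightarrow> 'l) monoid" where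
  "L_quot G S =
    \<lparr>carrier = L_coset G S ` carrier G,
     mult = (\<lambda>A B. THE C. \<exists>x\<in>carrier G. \<exists>y\<in>carrier G.
        A = L_coset G S x \<and> B = L_coset G S y \<and> C = L_coset G S (x \<otimes>\<^bsub>G\<^esub> y)),
     one = L_coset G S \<one>\<^bsub>G\<^esub>\<rparr>"

definition L_quot_ord ::
  "('a, 'b) monoid_scheme \<Rightarrow> ('a \<Rightarrow> 'a \<Rightarrow> 'l) \<Rightarrow> ('a \<Rightarrow> 'l::frame) \<Rightarrow> ('a \<Rightarrow> 'l) \<Rightarrow> ('a \<Rightarrow> 'l) \<Rightarrow> 'l" where
  "L_quot_ord G e S A B = (THE l. \<exists>a\<in>carrier G. \<exists>b\<in>carrier G.
     A = L_coset G S a \<and> B = L_coset G S b \<and>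
     l = (SUP x\<in>L_level G S (S \<one>\<^bsub>G\<^esub>). e (a \<otimes>\<^bsub>G\<^esub> inv\<^bsub>G\<^esub> b) x))"

definition L_quot_map :: "('a, 'b) monoid_scheme \<Rightarrow> ('a \<Rightarrow> 'l::frame) \<Rightarrow> ('a \<Rightarrow> 'l) \<Rightarrow> 'l" where
  "L_quot_map G S A = (THE l. \<exists>a\<in>carrier G. A = L_coset G S a \<and> l = S a)"

context L_subgroup
begin

lemma L_coset_eq:
  assumes "x \<in> carrier G" "y \<in> carrier G"
  shows "L_coset G S x y = S (inv x \<otimes> y)"
proof -
  have "{S t | t. t \<in> carrier G \<and> x \<otimes> t = y} = {S (inv x \<otimes> y)}"
    using assms by (auto simp: inv_solve_left' m_assoc[symmetric])
  then show ?thesis by (simp add: L_coset_def)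
qed

lemma L_coset_off_carrier:
  assumes "x \<in> carrier G" "y \<notin> carrier G"
  shows "L_coset G S x y = Orderings.bot"
proof -
  have "{S t | t. t \<in> carrier G \<and> x \<otimes> t = y} = {}"
    using assms by auto
  then show ?thesis by (simp only: L_coset_def Sup_empty)
qed

lemma L_coset_one: "y \<in> carrier G \<Longrightarrow> L_coset G S \<one> y = S y"
  by (simp add: L_coset_eq)

lemma le_one: "x \<in> carrier G \<Longrightarrow> S x \<le> S \<one>"
  using L_mult[of x "inv x"] L_inv[of x] by simp

lemma L_coset_eq_iff:
  assumes x: "x \<in> carrier G" and y: "y \<in> carrier G"
  shows "L_coset G S x = L_coset G S y \<longleftrightarrow> S (inv x \<otimes> y) = S \<one>"
proof
  assume "L_coset G S x = L_coset G S y"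
  then have "L_coset G S x y = L_coset G S y y" by simp
  then show "S (inv x \<otimes> y) = S \<one>" using x y by (simp add: L_coset_eq)
next
  assume eq: "S (inv x \<otimes> y) = S \<one>"
  have le: "S (inv v \<otimes> z) \<le> S (inv u \<otimes> z)"
    if "u \<in> carrier G" "v \<in> carrier G" "z \<in> carrier G" "S (inv u \<otimes> v) = S \<one>" for u v z
  proof -
    have "S (inv v \<otimes> z) = inf (S (inv u \<otimes> v)) (S (inv v \<otimes> z))"
      using that le_one[of "inv v \<otimes> z"] by (simp add: inf_absorb2)
    also have "\<dots> \<le> S ((inv u \<otimes> v) \<otimes> (inv v \<otimes> z))"
      using that by (intro L_mult) auto
    also have "(inv u \<otimes> v) \<otimes> (inv v \<otimes> z) = inv u \<otimes> z"
      using that by (metis inv_closed m_assoc m_closed r_inv l_one)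
    finally show ?thesis .
  qed
  have eq': "S (inv y \<otimes> x) = S \<one>"
    using eq L_inv[of "inv x \<otimes> y"] x y by (simp add: inv_mult_group)
  show "L_coset G S x = L_coset G S y"
  proof
    fix z
    show "L_coset G S x z = L_coset G S y z"
      using le[OF x y _ eq] le[OF y x _ eq'] x y
      by (cases "z \<in> carrier G") (auto simp: L_coset_eq L_coset_off_carrier intro: antisym)
  qed
qed

end

lemma (in normal_L_subgroup) L_quot_mult:
  assumes x: "x \<in> carrier G" and y: "y \<in> carrier G"
  shows "L_coset G S x \<otimes>\<^bsub>L_quot G S\<^esub> L_coset G S y = L_coset G S (x \<otimes> y)"
proof -
  have "L_coset G S (u \<otimes> v) = L_coset G S (x \<otimes> y)"
    if uv: "u \<in> carrier G" "v \<in> carrier G"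
      and eq: "L_coset G S x = L_coset G S u" "L_coset G S y = L_coset G S v" for u v
  proof -
    let ?p = "inv x \<otimes> u" and ?q = "inv y \<otimes> v"
    have 1: "S ?p = S \<one>" "S ?q = S \<one>" using eq uv x y by (auto simp: L_coset_eq_iff)
    have "S \<one> \<le> S (inv y \<otimes> ?p \<otimes> inv (inv y))"
      using L_normal[of "inv y" ?p] 1 x y uv by simp
    then have "S \<one> \<le> inf (S (inv y \<otimes> ?p \<otimes> inv (inv y))) (S ?q)" using 1 by simp
    also have "\<dots> \<le> S ((inv y \<otimes> ?p \<otimes> inv (inv y)) \<otimes> ?q)"
      using x y uv by (intro L_mult) auto
    also have "(inv y \<otimes> ?p \<otimes> inv (inv y)) \<otimes> ?q = inv (x \<otimes> y) \<otimes> (u \<otimes> v)"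
    proof -
      have "y \<otimes> (inv y \<otimes> v) = v" using y uv by (simp add: m_assoc[symmetric])
      then show ?thesis using x y uv by (simp add: m_assoc inv_mult_group)
    qed
    finally have "S (inv (x \<otimes> y) \<otimes> (u \<otimes> v)) = S \<one>"
      using x y uv by (intro antisym le_one) auto
    then show ?thesis using x y uv L_coset_eq_iff[of "x \<otimes> y" "u \<otimes> v"] by simp
  qed
  then show ?thesis
    unfolding L_quot_def monoid.simps using x y by (intro the_equality) blast+
qed

end

theory Submission
  imports Defs "HOL-Algebra.Coset"
begin

text \<open>
  The level set \<open>N = S\<inverse>(\<alpha>)\<close> is a normal subgroup, and two cosets of \<open>S\<close> coincide iff their
  representatives agree modulo \<open>N\<close>; so \<open>G + S\<close> is \<open>G / N\<close> with order degree
  \<open>SUP n\<in>N. e (a \<otimes> inv b) n\<close>. Translation by elements of \<open>N\<close> gives independence of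
  representatives and all the order axioms except antisymmetry. For that one,
  \<open>e (b \<otimes> inv a) m = e (inv m) (a \<otimes> inv b)\<close>, so convexity of \<open>S\<close> between \<open>inv m\<close> and \<open>n\<close>, together
  with distributivity, forces \<open>S (a \<otimes> inv b) \<ge> \<alpha>\<close>.
\<close>

section \<open>Meets of joins in a frame, and cancellation in a group\<close>

lemma inf_SUP_frame: "inf a (SUP i\<in>I. f i) = (SUP i\<in>I. inf a (f i :: 'l::frame))"
  using inf_Sup_frame[of a "f ` I"] by (simp add: image_image)

text \<open>Two uses of the frame law, one for each join, reduce the bound to single indices. The
  extra factor \<open>k\<close> is \<open>top\<close> in the proof of transitivity and
  \<open>inf (S x) (S y)\<close> in that of convexity.\<close>

lemma inf_SUP_inf_SUP_le:
  fixes c k :: "'l::frame"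
  assumes "\<And>i j. i \<in> I \<Longrightarrow> j \<in> J \<Longrightarrow> inf (inf k (f i)) (g j) \<le> c"
  shows "inf (inf k (SUP i\<in>I. f i)) (SUP j\<in>J. g j) \<le> c"
proof -
  have "inf (inf k (g j)) (SUP i\<in>I. f i) \<le> c" if "j \<in> J" for j
    unfolding inf_SUP_frame using assms that by (intro SUP_least) (simp add: ac_simps)
  then have "inf (inf k (SUP i\<in>I. f i)) (g j) \<le> c" if "j \<in> J" for j
    using that by (simp add: ac_simps)
  then show ?thesis
    unfolding inf_SUP_frame by (intro SUP_least)
qed

lemma (in group) inv_mult_cancel_left:
  assumes "x \<in> carrier G" "y \<in> carrier G"
  shows "inv x \<otimes> (x \<otimes> y) = y" "x \<otimes> (inv x \<otimes> y) = y"
  using assms by (simp_all add: m_assoc[symmetric])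

section \<open>The top level of an L-subgroup, and values of cosets\<close>

lemma (in L_subgroup) L_level_oneI:
  assumes "x \<in> carrier G" "S \<one> \<le> S x"
  shows "x \<in> L_level G S (S \<one>)"
  using assms le_one[of x] by (simp add: L_level_def antisym)

text \<open>Since \<open>S n = S \<one>\<close> is the greatest value of \<open>S\<close> on the
  carrier, the factor \<open>S n\<close> drops out of \<open>L_mult\<close>. Convexity uses this to
  translate its two endpoints by N without lowering \<open>S\<close>.\<close>

lemma (in L_subgroup) le_L_level_mult:
  assumes "n \<in> L_level G S (S \<one>)" "x \<in> carrier G"
  shows "S x \<le> S (n \<otimes> x)"
  using assms L_mult[of n x] le_one[of x] by (simp add: L_level_def inf_absorb2)

text \<open>This is why \<open>L_quot_map\<close> is well defined: \<open>S x\<close> can be read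
  off from the coset of \<open>x\<close> by evaluating it at \<open>\<one>\<close>.\<close>

lemma (in L_subgroup) L_coset_at_one: "x \<in> carrier G \<Longrightarrow> L_coset G S x \<one> = S x"
  using L_inv[of x] by (simp add: L_coset_eq)

lemma (in L_subgroup) L_quot_map_L_coset:
  assumes "a \<in> carrier G"
  shows "L_quot_map G S (L_coset G S a) = S a"
  unfolding L_quot_map_def using assms by (intro the_equality) (auto simp flip: L_coset_at_one)

section \<open>The quotient group and the induced normal L-subgroup\<close>

context normal_L_subgroup
begin

sublocale level: normal "L_level G S (S \<one>)" G
proof -
  have "subgroup (L_level G S (S \<one>)) G"
  proof
    show "x \<otimes> y \<in> L_level G S (S \<one>)"
      if "x \<in> L_level G S (S \<one>)" "y \<in> L_level G S (S \<one>)" for x y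
      using that L_mult[of x y] by (intro L_level_oneI) (auto simp: L_level_def)
  qed (auto simp: L_level_def simp flip: L_inv)
  moreover have "x \<otimes> h \<otimes> inv x \<in> L_level G S (S \<one>)"
    if "x \<in> carrier G" "h \<in> L_level G S (S \<one>)" for x h
    using that L_normal[of x h] by (intro L_level_oneI) (auto simp: L_level_def)
  ultimately show "L_level G S (S \<one>) \<lhd> G"
    unfolding normal_inv_iff by blast
qed

text \<open>\<open>L_coset_eq_iff\<close> compares representatives by a left quotient, whereas the
  order degree is built from the right quotient \<open>a \<otimes> inv b\<close>. Conjugation by
  \<open>y\<close>, under which N is stable, passes from one to the other.\<close>

lemma L_coset_eq_iff_level:
  assumes "x \<in> carrier G" "y \<in> carrier G"
  shows "L_coset G S x = L_coset G S y \<longleftrightarrow> x \<otimes> inv y \<in> L_level G S (S \<one>)"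
proof -
  have "L_coset G S x = L_coset G S y \<longleftrightarrow> inv y \<otimes> x \<in> L_level G S (S \<one>)"
    unfolding eq_commute[of "L_coset G S x"] using assms 
    by (simp add: L_coset_eq_iff L_level_def del: level.mem_carrier)
  also have "\<dots> \<longleftrightarrow> x \<otimes> inv y \<in> L_level G S (S \<one>)"
  proof
    assume "inv y \<otimes> x \<in> L_level G S (S \<one>)"
    then have "y \<otimes> (inv y \<otimes> x) \<otimes> inv y \<in> L_level G S (S \<one>)"
      using assms by (intro level.inv_op_closed2)
    then show "x \<otimes> inv y \<in> L_level G S (S \<one>)"
      using assms by (simp add: m_assoc[symmetric])
  next
    assume "x \<otimes> inv y \<in> L_level G S (S \<one>)"
    then have "inv y \<otimes> (x \<otimes> inv y) \<otimes> y \<in> L_level G S (S \<one>)"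
      using assms by (intro level.inv_op_closed1)
    then show "inv y \<otimes> x \<in> L_level G S (S \<one>)"
      using assms by (simp add: m_assoc)
  qed
  finally show ?thesis .
qed

lemma carrier_L_quot [simp]: "carrier (L_quot G S) = L_coset G S ` carrier G"
  by (simp add: L_quot_def)

lemma one_L_quot [simp]: "\<one>\<^bsub>L_quot G S\<^esub> = L_coset G S \<one>"
  by (simp add: L_quot_def)

lemma group_L_quot: "group (L_quot G S)"
proof (rule groupI)
  fix A assume "A \<in> carrier (L_quot G S)"
  then obtain a where "a \<in> carrier G" "A = L_coset G S a" by auto
  then show "\<exists>B\<in>carrier (L_quot G S). B \<otimes>\<^bsub>L_quot G S\<^esub> A = \<one>\<^bsub>L_quot G S\<^esub>"
    by (intro bexI[of _ "L_coset G S (inv a)"]) (auto simp: L_quot_mult)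
qed (auto simp: L_quot_mult m_assoc)

lemma inv_L_quot:
  assumes "x \<in> carrier G"
  shows "inv\<^bsub>L_quot G S\<^esub> (L_coset G S x) = L_coset G S (inv x)"
  using assms by (intro group.inv_equality[OF group_L_quot]) (auto simp: L_quot_mult)

lemma normal_L_subgroup_L_quot: "normal_L_subgroup (L_quot G S) (L_quot_map G S)"
proof (intro normal_L_subgroup.intro L_subgroup.intro group_L_quot
    L_subgroup_axioms.intro normal_L_subgroup_axioms.intro)
  fix A B assume "A \<in> carrier (L_quot G S)" "B \<in> carrier (L_quot G S)"
  then obtain a b where ab: "a \<in> carrier G" "A = L_coset G S a" "b \<in> carrier G" "B = L_coset G S b"
    by auto
  show "inf (L_quot_map G S A) (L_quot_map G S B) \<le> L_quot_map G S (A \<otimes>\<^bsub>L_quot G S\<^esub> B)"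
    using ab L_mult[of a b] by (simp add: L_quot_mult L_quot_map_L_coset)
  show "L_quot_map G S B
      \<le> L_quot_map G S (A \<otimes>\<^bsub>L_quot G S\<^esub> B \<otimes>\<^bsub>L_quot G S\<^esub> inv\<^bsub>L_quot G S\<^esub> A)"
    using ab L_normal[of a b] by (simp add: L_quot_mult inv_L_quot L_quot_map_L_coset)
next
  fix A assume "A \<in> carrier (L_quot G S)"
  then show "L_quot_map G S A = L_quot_map G S (inv\<^bsub>L_quot G S\<^esub> A)"
    by (auto simp: inv_L_quot L_quot_map_L_coset simp flip: L_inv)
qed

text \<open>A coset of \<open>a\<close> lies in this level exactly when \<open>a\<close> lies in N,
  that is, when \<open>a\<close> and \<open>\<one>\<close> have the same coset.\<close>

lemma L_level_L_quot_eq: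
  "L_level (L_quot G S) (L_quot_map G S) (S \<one>) = {L_coset G S \<one>}"
proof (intro equalityI subsetI)
  fix A assume "A \<in> L_level (L_quot G S) (L_quot_map G S) (S \<one>)"
  then obtain a where "a \<in> carrier G" "A = L_coset G S a" "L_quot_map G S A = S \<one>"
    unfolding L_level_def carrier_L_quot by blast
  then show "A \<in> {L_coset G S \<one>}"
    by (simp add: L_coset_eq_iff_level L_level_oneI L_quot_map_L_coset)
next
  fix A assume "A \<in> {L_coset G S \<one>}"
  then show "A \<in> L_level (L_quot G S) (L_quot_map G S) (S \<one>)"
    unfolding L_level_def by (simp add: L_quot_map_L_coset)
qed

end

section \<open>The induced order on the quotient\<close>

context L_filter
begin

text \<open>Used in both directions, this makes the join independent of representatives, so that the
  description in \<open>L_quot_ord\<close> denotes it.\<close>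

lemma SUP_level_le:
  assumes "a \<in> carrier G" "b \<in> carrier G" "u \<in> carrier G" "v \<in> carrier G"
    and eq: "L_coset G S a = L_coset G S u" "L_coset G S b = L_coset G S v"
  shows "(SUP x\<in>L_level G S (S \<one>). e (a \<otimes> inv b) x) \<le> (SUP x\<in>L_level G S (S \<one>). e (u \<otimes> inv v) x)"
proof (rule SUP_mono)
  fix x assume x: "x \<in> L_level G S (S \<one>)"
  \<comment> \<open>The outer factors lie in N because the cosets agree. The same two-sided
    translation takes \<open>a \<otimes> inv b\<close> to \<open>u \<otimes> inv v\<close>.\<close>
  let ?x = "(u \<otimes> inv a) \<otimes> x \<otimes> (b \<otimes> inv v)"
  have "u \<otimes> inv a \<in> L_level G S (S \<one>)" "b \<otimes> inv v \<in> L_level G S (S \<one>)"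
    using assms L_coset_eq_iff_level[of u a] L_coset_eq_iff_level[of b v] by auto
  then have "?x \<in> L_level G S (S \<one>)" using x by blast
  moreover have "e (a \<otimes> inv b) x \<le> e ((u \<otimes> inv a) \<otimes> (a \<otimes> inv b) \<otimes> (b \<otimes> inv v)) ?x"
    using assms x by (intro L_compat) auto
  moreover have "(u \<otimes> inv a) \<otimes> (a \<otimes> inv b) \<otimes> (b \<otimes> inv v) = u \<otimes> inv v"
    using assms by (simp add: m_assoc inv_mult_cancel_left)
  ultimately show "\<exists>y\<in>L_level G S (S \<one>). e (a \<otimes> inv b) x \<le> e (u \<otimes> inv v) y"
    by (intro bexI[of _ ?x]) simp_all
qed

lemma L_quot_ord_L_coset:
  assumes "a \<in> carrier G" "b \<in> carrier G"
  shows "L_quot_ord G e S (L_coset G S a) (L_coset G S b) =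
    (SUP x\<in>L_level G S (S \<one>). e (a \<otimes> inv b) x)"
  unfolding L_quot_ord_def using assms
  by (intro the_equality) (auto intro!: antisym SUP_level_le)

lemma e_le_mult_left:
  assumes "x \<in> carrier G" "y \<in> carrier G" "b \<in> carrier G"
  shows "e x y \<le> e (b \<otimes> x) (b \<otimes> y)"
  using assms L_compat[of x y \<one> b] by simp

lemma e_le_mult_right:
  assumes "x \<in> carrier G" "y \<in> carrier G" "a \<in> carrier G"
  shows "e x y \<le> e (x \<otimes> a) (y \<otimes> a)"
  using assms L_compat[of x y a \<one>] by simp

lemma convexD:
  assumes "x \<in> carrier G" "y \<in> carrier G" "a \<in> carrier G"
  shows "inf (inf (inf (S x) (S y)) (e x a)) (e a y) \<le> S a"
  using convex assms by (simp add: L_convex_def)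

lemma L_quot_ord_trans:
  assumes "a \<in> carrier G" "b \<in> carrier G" "c \<in> carrier G"
  shows "inf (L_quot_ord G e S (L_coset G S a) (L_coset G S b))
      (L_quot_ord G e S (L_coset G S b) (L_coset G S c))
    \<le> L_quot_ord G e S (L_coset G S a) (L_coset G S c)"
proof -
  have "inf (e (a \<otimes> inv b) m) (e (b \<otimes> inv c) n) \<le> (SUP x\<in>L_level G S (S \<one>). e (a \<otimes> inv c) x)"
    if mn: "m \<in> L_level G S (S \<one>)" "n \<in> L_level G S (S \<one>)" for m n
  proof -
    \<comment> \<open>Translating the first degree on the right by \<open>b \<otimes> inv c\<close>
      and the second on the left by \<open>m\<close> gives them the common middle point
      \<open>m \<otimes> (b \<otimes> inv c)\<close>. The chain then ends at
      \<open>m \<otimes> n\<close>, again in N.\<close>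
    have "e (a \<otimes> inv b) m \<le> e ((a \<otimes> inv b) \<otimes> (b \<otimes> inv c)) (m \<otimes> (b \<otimes> inv c))"
      using assms mn by (intro e_le_mult_right) auto
    also have "(a \<otimes> inv b) \<otimes> (b \<otimes> inv c) = a \<otimes> inv c"
      using assms by (simp add: m_assoc inv_mult_cancel_left)
    finally have "inf (e (a \<otimes> inv b) m) (e (b \<otimes> inv c) n)
      \<le> inf (e (a \<otimes> inv c) (m \<otimes> (b \<otimes> inv c))) (e (m \<otimes> (b \<otimes> inv c)) (m \<otimes> n))"
      using assms mn by (intro inf_mono e_le_mult_left) auto
    also have "\<dots> \<le> e (a \<otimes> inv c) (m \<otimes> n)"
      using assms mn by (intro L_trans) auto
    also have "\<dots> \<le> (SUP x\<in>L_level G S (S \<one>). e (a \<otimes> inv c) x)"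
      using mn by (intro SUP_upper level.m_closed)
    finally show ?thesis .
  qed
  then show ?thesis
    using assms inf_SUP_inf_SUP_le[where k = Orderings.top
        and f = "e (a \<otimes> inv b)" and g = "e (b \<otimes> inv c)"]
    by (simp add: L_quot_ord_L_coset)
qed

text \<open>For fixed \<open>m\<close> and \<open>n\<close> in N, translation turns the two degrees
  into \<open>e (inv m \<otimes> x) a\<close> and \<open>e a (n \<otimes> y)\<close>. Convexity of
  \<open>S\<close> between these endpoints applies, and \<open>S\<close> is at least
  \<open>S x\<close> and \<open>S y\<close> there. The case \<open>x = y = \<one>\<close> also
  serves antisymmetry.\<close>

lemma L_quot_map_convex:
  assumes "x \<in> carrier G" "y \<in> carrier G" "a \<in> carrier G"
  shows "inf (inf (inf (S x) (S y)) (L_quot_ord G e S (L_coset G S x) (L_coset G S a)))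
      (L_quot_ord G e S (L_coset G S a) (L_coset G S y)) \<le> S a"
  unfolding L_quot_ord_L_coset[OF assms(1,3)] L_quot_ord_L_coset[OF assms(3,2)]
proof (rule inf_SUP_inf_SUP_le)
  fix m n assume mn: "m \<in> L_level G S (S \<one>)" "n \<in> L_level G S (S \<one>)"
  have "e (x \<otimes> inv a) m \<le> e (inv m \<otimes> (x \<otimes> inv a) \<otimes> a) (inv m \<otimes> m \<otimes> a)"
    using assms mn by (intro L_compat) auto
  also have "\<dots> = e (inv m \<otimes> x) a"
    using assms mn by (simp add: m_assoc inv_mult_cancel_left)
  finally have 1: "e (x \<otimes> inv a) m \<le> e (inv m \<otimes> x) a" .
  have "e (a \<otimes> inv y) n \<le> e (a \<otimes> inv y \<otimes> y) (n \<otimes> y)"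
    using assms mn by (intro e_le_mult_right) auto
  also have "\<dots> = e a (n \<otimes> y)"
    using assms mn by (simp add: m_assoc inv_mult_cancel_left)
  finally have 2: "e (a \<otimes> inv y) n \<le> e a (n \<otimes> y)" .
  have "inf (inf (inf (S x) (S y)) (e (x \<otimes> inv a) m)) (e (a \<otimes> inv y) n)
    \<le> inf (inf (inf (S (inv m \<otimes> x)) (S (n \<otimes> y))) (e (inv m \<otimes> x) a)) (e a (n \<otimes> y))"
    using assms mn by (intro inf_mono 1 2 le_L_level_mult level.m_inv_closed)
  also have "\<dots> \<le> S a"
    using assms mn by (intro convexD) auto
  finally show "inf (inf (inf (S x) (S y)) (e (x \<otimes> inv a) m)) (e (a \<otimes> inv y) n) \<le> S a" .
qed

lemma L_quot_ord_compat:
  assumes "x \<in> carrier G" "y \<in> carrier G" "a \<in> carrier G" "b \<in> carrier G"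
  shows "L_quot_ord G e S (L_coset G S x) (L_coset G S y)
    \<le> L_quot_ord G e S (L_coset G S (b \<otimes> x \<otimes> a)) (L_coset G S (b \<otimes> y \<otimes> a))"
proof -
  have "(SUP n\<in>L_level G S (S \<one>). e (x \<otimes> inv y) n)
    \<le> (SUP n\<in>L_level G S (S \<one>). e ((b \<otimes> x \<otimes> a) \<otimes> inv (b \<otimes> y \<otimes> a)) n)"
  proof (rule SUP_mono)
    fix n assume n: "n \<in> L_level G S (S \<one>)"
    \<comment> \<open>The right factor \<open>a\<close> cancels in the quotient of the translated
      elements. Only conjugation by \<open>b\<close> remains, and it preserves N.\<close>
    have "e (x \<otimes> inv y) n \<le> e (b \<otimes> (x \<otimes> inv y) \<otimes> inv b) (b \<otimes> n \<otimes> inv b)"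
      using assms n by (intro L_compat) auto
    moreover have "b \<otimes> (x \<otimes> inv y) \<otimes> inv b = (b \<otimes> x \<otimes> a) \<otimes> inv (b \<otimes> y \<otimes> a)"
      using assms by (simp add: m_assoc inv_mult_group inv_mult_cancel_left)
    moreover have "b \<otimes> n \<otimes> inv b \<in> L_level G S (S \<one>)"
      using assms n by (intro level.inv_op_closed2)
    ultimately show "\<exists>m\<in>L_level G S (S \<one>).
      e (x \<otimes> inv y) n \<le> e ((b \<otimes> x \<otimes> a) \<otimes> inv (b \<otimes> y \<otimes> a)) m"
      by auto
  qed
  then show ?thesis
    using assms by (simp add: L_quot_ord_L_coset)
qed

lemma L_quot_ord_refl:
  assumes "a \<in> carrier G"
  shows "L_quot_ord G e S (L_coset G S a) (L_coset G S a) = Orderings.top"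
proof -
  \<comment> \<open>The right quotient of \<open>a\<close> by itself is \<open>\<one>\<close>, which
    is one of the indices of the join.\<close>
  have "e \<one> \<one> \<le> (SUP x\<in>L_level G S (S \<one>). e \<one> x)"
    by (intro SUP_upper level.one_closed)
  then show ?thesis
    using assms by (simp add: L_quot_ord_L_coset L_refl top_unique)
qed

lemma L_quot_ord_antisym:
  assumes a: "a \<in> carrier G" and b: "b \<in> carrier G"
    and ab: "L_quot_ord G e S (L_coset G S a) (L_coset G S b) = Orderings.top"
    and ba: "L_quot_ord G e S (L_coset G S b) (L_coset G S a) = Orderings.top"
  shows "L_coset G S a = L_coset G S b"
proof -
  let ?c = "a \<otimes> inv b"
  \<comment> \<open>Compatibility with right translation by \<open>inv b\<close> moves the pair
    \<open>a\<close>, \<open>b\<close> to \<open>?c\<close>, \<open>\<one>\<close>. The coset of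
    \<open>?c\<close> is then above and below the neutral one with degree \<open>top\<close>, and
    convexity at \<open>\<one>\<close>, \<open>\<one>\<close> gives
    \<open>S \<one> \<le> S ?c\<close>.\<close>
  have "L_quot_ord G e S (L_coset G S \<one>) (L_coset G S ?c) = Orderings.top"
    "L_quot_ord G e S (L_coset G S ?c) (L_coset G S \<one>) = Orderings.top"
    using a b L_quot_ord_compat[OF a b, of "inv b" \<one>] L_quot_ord_compat[OF b a, of "inv b" \<one>]
    by (simp_all add: ab ba top_unique)
  then have "S \<one> \<le> S ?c"
    using L_quot_map_convex[of \<one> \<one> ?c] a b by simp
  then show ?thesis
    using a b by (simp add: L_coset_eq_iff_level L_level_oneI)
qed

lemma L_ordered_group_L_quot: "L_ordered_group (L_quot G S) (L_quot_ord G e S)"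
proof (intro L_ordered_group.intro group_L_quot L_ordered_set.intro L_ordered_group_axioms.intro)
  show "L_quot_ord G e S A A = Orderings.top" if "A \<in> carrier (L_quot G S)" for A
    using that by (auto simp: L_quot_ord_refl)
  show "inf (L_quot_ord G e S A B) (L_quot_ord G e S B C) \<le> L_quot_ord G e S A C"
    if "A \<in> carrier (L_quot G S)" "B \<in> carrier (L_quot G S)" "C \<in> carrier (L_quot G S)" for A B C
    using that by (auto simp: L_quot_ord_trans)
  show "A = B"
    if "A \<in> carrier (L_quot G S)" "B \<in> carrier (L_quot G S)"
      "L_quot_ord G e S A B = Orderings.top" "L_quot_ord G e S B A = Orderings.top" for A B
    using that L_quot_ord_antisym by auto
  show "L_quot_ord G e S X Y \<le> L_quot_ord G e S (B \<otimes>\<^bsub>L_quot G S\<^esub> X \<otimes>\<^bsub>L_quot G S\<^esub> A)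
      (B \<otimes>\<^bsub>L_quot G S\<^esub> Y \<otimes>\<^bsub>L_quot G S\<^esub> A)"
    if "X \<in> carrier (L_quot G S)" "Y \<in> carrier (L_quot G S)"
      "A \<in> carrier (L_quot G S)" "B \<in> carrier (L_quot G S)" for X Y A B
    using that by (auto simp: L_quot_mult L_quot_ord_compat)
qed

lemma L_filter_L_quot: "L_filter (L_quot G S) (L_quot_ord G e S) (L_quot_map G S)"
  by (intro L_filter.intro L_ordered_group_L_quot normal_L_subgroup_L_quot L_filter_axioms.intro)
    (auto simp: L_convex_def L_quot_map_L_coset L_quot_map_convex)

end

theorem theorem4p14:
  fixes G :: "('a, 'b) monoid_scheme"
    and e :: "'a \<Rightarrow> 'a \<Rightarrow> 'l::frame"
    and S :: "'a \<Rightarrow> 'l"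
    and \<alpha> :: 'l
  assumes "L_ordered_group G e"
    and "L_filter G e S"
    and "\<alpha> = S \<one>\<^bsub>G\<^esub>"
  shows "(\<forall>a\<in>carrier G. \<forall>b\<in>carrier G.
            L_quot_ord G e S (L_coset G S a) (L_coset G S b)
              = (SUP x\<in>L_level G S \<alpha>. e (a \<otimes>\<^bsub>G\<^esub> inv\<^bsub>G\<^esub> b) x))
       \<and> L_ordered_group (L_quot G S) (L_quot_ord G e S)
       \<and> (\<forall>a\<in>carrier G. L_quot_map G S (L_coset G S a) = S a)
       \<and> L_filter (L_quot G S) (L_quot_ord G e S) (L_quot_map G S)
       \<and> (\<exists>!A. A \<in> L_level (L_quot G S) (L_quot_map G S) \<alpha>)"
proof -
  interpret L_filter G e S by fact
  show ?thesis
    \<comment> \<open>Once \<alpha> is written as \<open>S \<one>\<close>, the level set in the last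
      conjunct becomes the singleton of the neutral coset.\<close>
    unfolding assms(3) L_level_L_quot_eq
    by (simp add: L_quot_ord_L_coset L_ordered_group_L_quot L_quot_map_L_coset L_filter_L_quot)
qed

end
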